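(* Let $0\leq k\leq m-1$ be integers and let $p$ be a prime. (a) Then $1\leq s_p(\Delta^m_{(k)})\leq m-k$. (b) If $m\leq p$, then $s_p(\Delta^m_{(k)})=m-k$.
   Context: For a prime $p$ and an integer $n\ge 0$, the universal simplicial complex $X(\mathbb{F}_p^n)$ is the abstract simplicial complex whose vertices are the nonzero vectors of $\mathbb{F}_p^n$ and whose simplices are the sets of vectors that are linearly independent over $\mathbb{F}_p$. A simplicial map is nondegenerate if it is injective on the vertex set of every simplex (equivalently, it maps every $j$-simplex onto a $j$-simplex). For a finite simplicial complex $\mathcal{K}$ with $N$ vertices, the mod $p$ Buchstaber invariant of $\mathcal{K}$ is the integer $s_p(\mathcal{K})=N-r$, where $r$ is the least integer such that there is a nondegenerate simplicial map $\mathcal{K}\to X(\mathbb{F}_p^r)$. $\Delta^m$ is the $m$-simplex on the vertex set $\{1,\ldots,m+1\}$, and $\Delta^m_{(k)}$ is its $k$-skeleton, i.e. the simplices are the subsets of $\{1,\ldots,m+1\}$ with at most $k+1$ elements. *)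

theory Defs
  imports "Jordan_Normal_Form.VS_Connect" "Berlekamp_Zassenhaus.Finite_Field"
begin

text \<open>
  An abstract simplicial complex is represented by its set of simplices; the empty simplex is
  included, and the vertices are the elements of the simplices.
\<close>

definition abstract_simplicial_complex :: "'a set set \<Rightarrow> bool" where
  "abstract_simplicial_complex K \<longleftrightarrow>
     {} \<in> K \<and> (\<forall>\<sigma>\<in>K. finite \<sigma> \<and> (\<forall>\<tau>. \<tau> \<subseteq> \<sigma> \<longrightarrow> \<tau> \<in> K))"

definition vertices :: "'a set set \<Rightarrow> 'a set" where
  "vertices K = \<Union>K"

text \<open>Only the values of a map on the vertices of its domain complex matter.\<close>

definition simplicial_map :: "'a set set \<Rightarrow> 'b set set \<Rightarrow> ('a \<Rightarrow> 'b) \<Rightarrow> bool" where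
  "simplicial_map K L f \<longleftrightarrow> (\<forall>\<sigma>\<in>K. f ` \<sigma> \<in> L)"

definition nondegenerate_map :: "'a set set \<Rightarrow> 'b set set \<Rightarrow> ('a \<Rightarrow> 'b) \<Rightarrow> bool" where
  "nondegenerate_map K L f \<longleftrightarrow> simplicial_map K L f \<and> (\<forall>\<sigma>\<in>K. inj_on f \<sigma>)"

text \<open>
  For a type \<open>'p\<close> of prime cardinality \<open>p\<close>, the type \<open>'p mod_ring\<close> is the field of integers
  modulo \<open>p\<close>. The prime is thus a type parameter, and \<open>carrier_vec n\<close> is the space of vectors
  of length \<open>n\<close> over this field.
\<close>

definition universal_complex :: "nat \<Rightarrow> 'p::prime_card mod_ring vec set set" where
  "universal_complex n =
     {S. S \<subseteq> carrier_vec n - {0\<^sub>v n} \<and>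
         \<not> module.lin_dep class_ring (module_vec TYPE('p mod_ring) n) S}"

definition buchstaber_rank :: "'p::prime_card itself \<Rightarrow> 'a set set \<Rightarrow> nat" where
  "buchstaber_rank _ K =
     (LEAST r. \<exists>f. nondegenerate_map K (universal_complex r :: 'p mod_ring vec set set) f)"

definition mod_buchstaber :: "'p::prime_card itself \<Rightarrow> 'a set set \<Rightarrow> int" where
  "mod_buchstaber P K = int (card (vertices K)) - int (buchstaber_rank P K)"

definition standard_simplex :: "nat \<Rightarrow> nat set set" where
  "standard_simplex m = Pow {1..m + 1}"

definition skeleton :: "nat \<Rightarrow> 'a set set \<Rightarrow> 'a set set" where
  "skeleton k K = {\<sigma> \<in> K. card \<sigma> \<le> k + 1}"

lemma abstract_simplicial_complex_skeleton_simplex: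
  "abstract_simplicial_complex (skeleton k (standard_simplex m))"
proof -
  have "card \<tau> \<le> k + 1" if "\<sigma> \<subseteq> {1..m + 1}" "card \<sigma> \<le> k + 1" "\<tau> \<subseteq> \<sigma>" for \<sigma> \<tau> :: "nat set"
    using card_mono[OF finite_subset[OF that(1) finite_atLeastAtMost] that(3)] that(2) by linarith
  then show ?thesis
    by (auto simp: abstract_simplicial_complex_def skeleton_def standard_simplex_def
        intro: finite_subset)
qed

lemma vertices_skeleton_simplex: "vertices (skeleton k (standard_simplex m)) = {1..m + 1}"
proof -
  have "{x} \<in> skeleton k (standard_simplex m)" if "x \<in> {1..m + 1}" for x
    using that by (auto simp: skeleton_def standard_simplex_def)
  then have "{1..m + 1} \<subseteq> vertices (skeleton k (standard_simplex m))"
    unfolding vertices_def by blast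
  moreover have "vertices (skeleton k (standard_simplex m)) \<subseteq> {1..m + 1}"
    unfolding vertices_def skeleton_def standard_simplex_def by blast
  ultimately show ?thesis
    by blast
qed

lemma finite_carrier_vec_mod_ring:
  "finite (carrier_vec n :: 'p::prime_card mod_ring vec set)"
proof -
  have "(carrier_vec n :: 'p mod_ring vec set)
    \<subseteq> (\<lambda>xs. vec_of_list xs) ` {xs. set xs \<subseteq> UNIV \<and> length xs = n}"
  proof
    fix v :: "'p mod_ring vec"
    assume "v \<in> carrier_vec n"
    then have "length (list_of_vec v) = n" "v = vec_of_list (list_of_vec v)"
      by (auto simp: vec_list)
    then show "v \<in> (\<lambda>xs. vec_of_list xs) ` {xs. set xs \<subseteq> UNIV \<and> length xs = n}"
      by blast
  qed
  then show ?thesis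
    by (rule finite_subset) (intro finite_imageI finite_lists_length_eq finite_class.finite_UNIV)
qed

lemma abstract_simplicial_complex_universal_complex:
  "abstract_simplicial_complex (universal_complex n :: 'p::prime_card mod_ring vec set set)"
proof -
  interpret vec_space "TYPE('p mod_ring)" n .
  have "finite S" if "S \<subseteq> carrier_vec n" for S :: "'p mod_ring vec set"
    using that finite_carrier_vec_mod_ring finite_subset by blast
  moreover have "lin_indpt T" if "lin_indpt S" "T \<subseteq> S" for S T
    using that supset_ld_is_ld by blast
  moreover have "lin_indpt {}"
    by (simp add: lin_dep_def)
  ultimately show ?thesis
    unfolding abstract_simplicial_complex_def universal_complex_def by blast
qed

lemma vertices_universal_complex:
  "vertices (universal_complex n :: 'p::prime_card mod_ring vec set set)
     = carrier_vec n - {0\<^sub>v n}"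
proof -
  interpret vec_space "TYPE('p mod_ring)" n .
  have "lin_indpt {v}" if v: "v \<in> carrier_vec n" "v \<noteq> 0\<^sub>v n" for v
  proof
    assume "lin_dep {v}"
    then obtain a where a: "lincomb a {v} = 0\<^sub>v n" "a v \<noteq> 0"
      using finite_lin_dep[of "{v}"] v by auto
    then have "a v \<cdot>\<^sub>v v = 0\<^sub>v n"
      using that by (simp add: lincomb_def)
    then have "inverse (a v) \<cdot>\<^sub>v (a v \<cdot>\<^sub>v v) = 0\<^sub>v n"
      by simp
    then show False
      using a that by (simp add: smult_smult_assoc)
  qed
  then have "{v} \<in> universal_complex n" if "v \<in> carrier_vec n" "v \<noteq> 0\<^sub>v n" for v :: "'p mod_ring vec"
    using that by (auto simp: universal_complex_def)
  then have "carrier_vec n - {0\<^sub>v n} \<subseteq> vertices (universal_complex n :: 'p mod_ring vec set set)"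
    unfolding vertices_def by blast
  moreover have "vertices (universal_complex n :: 'p mod_ring vec set set) \<subseteq> carrier_vec n - {0\<^sub>v n}"
    unfolding vertices_def universal_complex_def by blast
  ultimately show ?thesis
    by blast
qed

end

theory Submission
  imports Defs
begin

text \<open>
  Write $r$ for the least dimension into which the skeleton maps nondegenerately. The skeleton
  has $m + 1$ vertices, so the claims are $k + 1 \le r \le m$, and $r = k + 1$ if $m \le p$. A
  nondegenerate map to the universal complex is the same as a placement of the $m + 1$ vertices
  at vectors of which any $k + 1$ are linearly independent.

  For the lower bound, the image of a single $k$-simplex already consists of $k + 1$ independent
  vectors. The upper bounds come from two placements. In dimension $m$, take the unit vectors and
  the sum of all of them: any $m$ of these $m + 1$ vectors form a basis. In dimension $k + 1$,
  take points of the rational normal curve, that is, the moment vectors $(1, a, \ldots, a^k)$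
  together with the point at infinity $(0, \ldots, 0, 1)$. The curve has $p + 1$ points over
  the field with $p$ elements, enough for all vertices exactly when $m \le p$.

  Independence and injectivity on a simplex are checked together by means of dual functionals
  (\<open>nondegenerate_to_universal_complexI\<close>): for each vertex of the simplex there is a functional
  that is nonzero at its image and zero at the images of the other vertices. For
  the rational normal curve these functionals are polynomials with prescribed roots.
\<close>

section \<open>Nondegenerate maps to the universal complex\<close>

text \<open>
  Pairing a vanishing linear combination with the functional that isolates one vector leaves only
  the term of that vector, so its coefficient is zero.
\<close>

lemma lin_indpt_if_separating_functionals:
  fixes S :: "'a::field vec set"
  assumes S: "S \<subseteq> carrier_vec n"
    and sep: "\<And>v. v \<in> S \<Longrightarrow>
      \<exists>w\<in>carrier_vec n. v \<bullet> w \<noteq> 0 \<and> (\<forall>u\<in>S - {v}. u \<bullet> w = 0)"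
  shows "\<not> module.lin_dep class_ring (module_vec TYPE('a) n) S"
proof
  interpret vec_space "TYPE('a)" n .
  assume "lin_dep S"
  then obtain A a v where A: "finite A" "A \<subseteq> S" "lincomb a A = 0\<^sub>v n" "v \<in> A" "a v \<noteq> 0"
    unfolding lin_dep_def by auto
  then obtain w where w: "w \<in> carrier_vec n" "v \<bullet> w \<noteq> 0" "\<forall>u\<in>S - {v}. u \<bullet> w = 0"
    using sep by blast
  have carr: "u \<in> carrier_vec n" if "u \<in> A" for u
    using that A(2) S by blast
  have "0 = lincomb a A \<bullet> w"
    using A(3) w(1) by simp
  also have "\<dots> = (\<Sum>u\<in>A. (a u \<cdot>\<^sub>v u) \<bullet> w)"
    unfolding lincomb_def by (rule finsum_scalar_prod_sum) (use carr w in auto)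
  also have "\<dots> = (\<Sum>u\<in>A. a u * (u \<bullet> w))"
    by (rule sum.cong) (use carr w in auto)
  also have "\<dots> = (\<Sum>u\<in>{v}. a u * (u \<bullet> w))"
    by (rule sum.mono_neutral_right) (use A w in auto)
  finally show False
    using A(5) w(2) by simp
qed

lemma nondegenerate_to_universal_complexI:
  fixes f :: "'a \<Rightarrow> 'p::prime_card mod_ring vec"
  assumes carr: "\<And>\<sigma> i. \<sigma> \<in> K \<Longrightarrow> i \<in> \<sigma> \<Longrightarrow> f i \<in> carrier_vec n"
    and sep: "\<And>\<sigma> i. \<sigma> \<in> K \<Longrightarrow> i \<in> \<sigma> \<Longrightarrow>
      \<exists>w\<in>carrier_vec n. f i \<bullet> w \<noteq> 0 \<and> (\<forall>j\<in>\<sigma> - {i}. f j \<bullet> w = 0)"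
  shows "nondegenerate_map K (universal_complex n) f"
  unfolding nondegenerate_map_def simplicial_map_def
proof (intro conjI ballI)
  fix \<sigma>
  assume \<sigma>: "\<sigma> \<in> K"
  show "inj_on f \<sigma>"
  proof (rule inj_onI)
    fix i j
    assume ij: "i \<in> \<sigma>" "j \<in> \<sigma>" "f i = f j"
    obtain w where "f i \<bullet> w \<noteq> 0" "\<forall>l\<in>\<sigma> - {i}. f l \<bullet> w = 0"
      using sep[OF \<sigma> ij(1)] by blast
    then show "i = j"
      using ij by auto
  qed
  have "f i \<noteq> 0\<^sub>v n" if "i \<in> \<sigma>" for i
    using sep[OF \<sigma> that] by auto
  then have "f ` \<sigma> \<subseteq> carrier_vec n - {0\<^sub>v n}"
    using carr[OF \<sigma>] by auto
  moreover have "\<not> module.lin_dep class_ring (module_vec TYPE('p mod_ring) n) (f ` \<sigma>)"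
  proof (rule lin_indpt_if_separating_functionals)
    show "f ` \<sigma> \<subseteq> carrier_vec n"
      using carr[OF \<sigma>] by blast
    fix v
    assume "v \<in> f ` \<sigma>"
    then obtain i where i: "i \<in> \<sigma>" "v = f i"
      by blast
    obtain w where "w \<in> carrier_vec n" "f i \<bullet> w \<noteq> 0" "\<forall>l\<in>\<sigma> - {i}. f l \<bullet> w = 0"
      using sep[OF \<sigma> i(1)] by blast
    then show "\<exists>w\<in>carrier_vec n. v \<bullet> w \<noteq> 0 \<and> (\<forall>u\<in>f ` \<sigma> - {v}. u \<bullet> w = 0)"
      using i(2) by auto
  qed
  ultimately show "f ` \<sigma> \<in> universal_complex n"
    unfolding universal_complex_def by blast
qed

lemma card_simplex_le_of_nondegenerate:
  fixes f :: "'a \<Rightarrow> 'p::prime_card mod_ring vec"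
  assumes f: "nondegenerate_map K (universal_complex n) f" and \<sigma>: "\<sigma> \<in> K"
  shows "card \<sigma> \<le> n"
proof -
  interpret vec_space "TYPE('p mod_ring)" n .
  have "f ` \<sigma> \<in> universal_complex n" and inj: "inj_on f \<sigma>"
    using f \<sigma> unfolding nondegenerate_map_def simplicial_map_def by blast+
  then have "f ` \<sigma> \<subseteq> carrier_vec n" "lin_indpt (f ` \<sigma>)"
    unfolding universal_complex_def by blast+
  then have "card (f ` \<sigma>) \<le> n"
    using li_le_dim(2)[of "f ` \<sigma>"] dim_is_n by simp
  then show ?thesis
    by (simp add: card_image inj)
qed

section \<open>Vectors in general position\<close>

lemma simplex_skeletonD:
  assumes "\<sigma> \<in> skeleton k (standard_simplex m)"
  shows "finite \<sigma>" "\<sigma> \<subseteq> {1..m + 1}" "card \<sigma> \<le> k + 1"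
  using assms by (auto simp: skeleton_def standard_simplex_def intro: finite_subset)

text \<open>
  A simplex with at most $m$ of the $m + 1$ vertices misses one of them. The functionals dual to
  the unit vectors can be corrected by the coordinate of a missing vertex so that they vanish on
  the sum of all unit vectors.
\<close>

lemma nondegenerate_unit_vecs_and_sum:
  assumes km: "k + 1 \<le> m"
  shows "\<exists>f. nondegenerate_map (skeleton k (standard_simplex m))
    (universal_complex m :: 'p::prime_card mod_ring vec set set) f"
proof -
  define f :: "nat \<Rightarrow> 'p mod_ring vec"
    where "f i = (if i = m + 1 then vec m (\<lambda>_. 1) else unit_vec m (i - 1))" for i
  have f_unit: "f i \<bullet> unit_vec m (j - 1) = (if i = m + 1 \<or> i = j then 1 else 0)"
    if "1 \<le> i" "i \<le> m + 1" "1 \<le> j" "j \<le> m" for i j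
    using that by (auto simp: f_def)
  have f_carr: "f i \<in> carrier_vec m" for i
    by (simp add: f_def)
  have "nondegenerate_map (skeleton k (standard_simplex m)) (universal_complex m) f"
  proof (rule nondegenerate_to_universal_complexI)
    fix \<sigma> i
    assume \<sigma>: "\<sigma> \<in> skeleton k (standard_simplex m)" and i: "i \<in> \<sigma>"
    note \<sigma>' = simplex_skeletonD[OF \<sigma>]
    have range: "1 \<le> l" "l \<le> m + 1" if "l \<in> \<sigma>" for l
      using \<sigma>'(2) that by auto
    show "\<exists>w\<in>carrier_vec m. f i \<bullet> w \<noteq> 0 \<and> (\<forall>l\<in>\<sigma> - {i}. f l \<bullet> w = 0)"
    proof (cases "m + 1 \<in> \<sigma>")
      case False
      then have l: "1 \<le> l" "l \<le> m + 1" "l \<noteq> m + 1" if "l \<in> \<sigma>" for l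
        using range that by blast+
      have im: "i \<le> m"
        using l[OF i] by simp
      have "f l \<bullet> unit_vec m (i - 1) = (if l = i then 1 else 0)" if "l \<in> \<sigma>" for l
        using f_unit[of l i] l[OF that] l[OF i] im by simp
      then show ?thesis
        using i by (intro bexI[of _ "unit_vec m (i - 1)"]) auto
    next
      case True
      have "\<not> {1..m + 1} \<subseteq> \<sigma>"
        using card_mono[OF \<sigma>'(1), of "{1..m + 1}"] \<sigma>'(3) km by auto
      then obtain j where "j \<in> {1..m + 1}" "j \<notin> \<sigma>"
        by blast
      then have j: "1 \<le> j" "j \<le> m + 1" "j \<notin> \<sigma>"
        by simp_all
      with True have jm: "j \<le> m"
        by (auto simp: le_Suc_eq)
      have f_j: "f l \<bullet> unit_vec m (j - 1) = (if l = m + 1 then 1 else 0)" if "l \<in> \<sigma>" for l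
        using f_unit[of l j] range[OF that] j jm that by auto
      show ?thesis
      proof (cases "i = m + 1")
        case True
        then show ?thesis
          using i f_j by (intro bexI[of _ "unit_vec m (j - 1)"]) auto
      next
        case False
        have im: "i \<le> m"
          using range[OF i] False by simp
        have "f l \<bullet> (unit_vec m (i - 1) - unit_vec m (j - 1)) = (if l = i then 1 else 0)"
          if "l \<in> \<sigma>" for l
        proof -
          have "f l \<bullet> (unit_vec m (i - 1) - unit_vec m (j - 1))
            = f l \<bullet> unit_vec m (i - 1) - f l \<bullet> unit_vec m (j - 1)"
            by (rule scalar_prod_minus_distrib[OF f_carr]) simp_all
          then show ?thesis
            using f_unit[of l i] f_j[OF that] range[OF that] range[OF i] im False by auto
        qed
        then show ?thesis
          using i by (intro bexI[of _ "unit_vec m (i - 1) - unit_vec m (j - 1)"]) auto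
      qed
    qed
  qed (rule f_carr)
  then show ?thesis
    by blast
qed

text \<open>
  A functional on the moment vectors is a polynomial given by its coefficients, and its value at a
  moment vector is the value of the polynomial.
\<close>

lemma moment_vec_scalar_prod:
  fixes q :: "'a::comm_ring_1 poly"
  assumes "degree q \<le> k"
  shows "vec (k + 1) (\<lambda>j. x ^ j) \<bullet> vec (k + 1) (poly.coeff q) = poly q x"
proof -
  have "vec (k + 1) (\<lambda>j. x ^ j) \<bullet> vec (k + 1) (poly.coeff q) = (\<Sum>j\<le>k. poly.coeff q j * x ^ j)"
    by (auto simp: scalar_prod_def atLeast0LessThan lessThan_Suc_atMost mult.commute
        intro!: sum.cong)
  also have "\<dots> = poly q x"
    unfolding poly_altdef using assms
    by (intro sum.mono_neutral_right) (auto simp: coeff_eq_0)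
  finally show ?thesis .
qed

text \<open>
  The point at infinity pairs with a polynomial by its coefficient of degree $k$. A point $a_i$ is
  therefore isolated by the product of the linear factors at the other finite points of the
  simplex; if the point at infinity is present too, there are fewer than $k$ such factors, and the
  product vanishes there. The point at infinity is isolated by a polynomial of degree exactly
  $k$ that vanishes at the finite points.
\<close>

lemma nondegenerate_rational_normal_curve:
  assumes mp: "m \<le> CARD('p::prime_card)"
  shows "\<exists>f. nondegenerate_map (skeleton k (standard_simplex m))
    (universal_complex (k + 1) :: 'p mod_ring vec set set) f"
proof -
  obtain a :: "nat \<Rightarrow> 'p mod_ring" where a: "inj_on a {1..m}"
    using card_le_inj[of "{1..m}" "UNIV :: 'p mod_ring set"] mp by auto
  define f :: "nat \<Rightarrow> 'p mod_ring vec"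
    where "f i = (if i = m + 1 then unit_vec (k + 1) k else vec (k + 1) (\<lambda>j. a i ^ j))" for i
  define P where "P T = (\<Prod>i\<in>T. [:- a i, 1:])" for T
  have deg_P: "degree (P T) = card T" for T
    unfolding P_def by (subst degree_prod_eq_sum_degree) auto
  have monic_P: "lead_coeff (P T) = 1" for T
    unfolding P_def by (simp add: lead_coeff_prod)
  have root_P: "poly (P T) (a i) = 0 \<longleftrightarrow> i \<in> T"
    if "finite T" "T \<subseteq> {1..m}" "i \<in> {1..m}" for T i
  proof -
    have "poly (P T) (a i) = 0 \<longleftrightarrow> (\<exists>j\<in>T. a i = a j)"
      using that(1) by (simp add: P_def poly_prod)
    also have "\<dots> \<longleftrightarrow> i \<in> T"
      using inj_onD[OF a] that(2,3) by blast
    finally show ?thesis .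
  qed
  have f_infinity: "f (m + 1) \<bullet> vec (k + 1) (poly.coeff q) = poly.coeff q k" for q
    by (simp add: f_def)
  have f_finite: "f i \<bullet> vec (k + 1) (poly.coeff q) = poly q (a i)"
    if "i \<noteq> m + 1" "degree q \<le> k" for i q
    using that moment_vec_scalar_prod[of q k "a i"] by (simp add: f_def)
  have "nondegenerate_map (skeleton k (standard_simplex m)) (universal_complex (k + 1)) f"
  proof (rule nondegenerate_to_universal_complexI)
    show "f i \<in> carrier_vec (k + 1)" for i
      by (simp add: f_def)
    fix \<sigma> i
    assume \<sigma>: "\<sigma> \<in> skeleton k (standard_simplex m)" and i: "i \<in> \<sigma>"
    note \<sigma>' = simplex_skeletonD[OF \<sigma>]
    have fin: "l \<in> {1..m}" if "l \<in> \<sigma>" "l \<noteq> m + 1" for l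
      using \<sigma>'(2) that by fastforce
    define T where "T = \<sigma> - {i} - {m + 1}"
    have T: "finite T" "T \<subseteq> {1..m}"
      using \<sigma>'(1) fin by (auto simp: T_def)
    have "card T \<le> card (\<sigma> - {i})"
      unfolding T_def using \<sigma>'(1) by (intro card_mono) auto
    then have card_T: "card T \<le> k"
      using i \<sigma>'(1,3) by simp
    show "\<exists>w\<in>carrier_vec (k + 1). f i \<bullet> w \<noteq> 0 \<and> (\<forall>l\<in>\<sigma> - {i}. f l \<bullet> w = 0)"
    proof (cases "i = m + 1")
      case True
      define q where "q = Polynomial.monom 1 (k - card T) * P T"
      have "P T \<noteq> 0"
        using monic_P[of T] by auto
      then have deg_q: "degree q = k"
        unfolding q_def using card_T
        by (subst degree_mult_eq) (auto simp: monom_eq_0_iff degree_monom_eq deg_P)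
      have "lead_coeff q = 1"
        unfolding q_def lead_coeff_mult lead_coeff_monom monic_P by simp
      then have "f i \<bullet> vec (k + 1) (poly.coeff q) \<noteq> 0"
        using f_infinity[of q] deg_q True by simp
      moreover have "f l \<bullet> vec (k + 1) (poly.coeff q) = 0" if "l \<in> \<sigma> - {i}" for l
      proof -
        have "l \<in> T" "l \<in> {1..m}" "l \<noteq> m + 1"
          using that True fin by (auto simp: T_def)
        then show ?thesis
          using f_finite[of l q] deg_q root_P[OF T, of l] by (simp add: q_def)
      qed
      ultimately show ?thesis
        by (intro bexI[of _ "vec (k + 1) (poly.coeff q)"]) auto
    next
      case False
      have "f i \<bullet> vec (k + 1) (poly.coeff (P T)) \<noteq> 0"
        using f_finite[OF False, of "P T"] root_P[OF T fin[OF i False]] card_T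
        by (simp add: deg_P T_def)
      moreover have "f l \<bullet> vec (k + 1) (poly.coeff (P T)) = 0" if l: "l \<in> \<sigma> - {i}" for l
      proof (cases "l = m + 1")
        case True
        then have "T \<subset> \<sigma> - {i}"
          using l by (auto simp: T_def)
        then have "card T < card (\<sigma> - {i})"
          using \<sigma>'(1) by (intro psubset_card_mono) auto
        then have "degree (P T) < k"
          using i \<sigma>'(1,3) by (simp add: deg_P)
        then show ?thesis
          using f_infinity[of "P T"] True by (simp add: coeff_eq_0)
      next
        case False
        then have "l \<in> T" "l \<in> {1..m}"
          using l fin by (auto simp: T_def)
        then show ?thesis
          using f_finite[OF False, of "P T"] root_P[OF T, of l] card_T by (simp add: deg_P)
      qed
      ultimately show ?thesis
        by (intro bexI[of _ "vec (k + 1) (poly.coeff (P T))"]) auto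
    qed
  qed
  then show ?thesis
    by blast
qed

section \<open>The mod p Buchstaber invariant of a skeleton\<close>

theorem proposition3p5:
  fixes k m p :: nat
  assumes "k + 1 \<le> m"
    and "p = CARD('p::prime_card)"
  shows "(1 \<le> mod_buchstaber TYPE('p) (skeleton k (standard_simplex m))
          \<and> mod_buchstaber TYPE('p) (skeleton k (standard_simplex m)) \<le> int m - int k)
       \<and> (m \<le> p \<longrightarrow> mod_buchstaber TYPE('p) (skeleton k (standard_simplex m)) = int m - int k)"
proof -
  let ?K = "skeleton k (standard_simplex m)"
  let ?r = "buchstaber_rank TYPE('p) ?K"
  have rank_le: "?r \<le> n"
    if "\<exists>f. nondegenerate_map ?K (universal_complex n :: 'p mod_ring vec set set) f" for n
    unfolding buchstaber_rank_def using that by (rule Least_le)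
  have upper: "?r \<le> m"
    by (rule rank_le[OF nondegenerate_unit_vecs_and_sum[OF assms(1)]])
  obtain f where f: "nondegenerate_map ?K (universal_complex ?r :: 'p mod_ring vec set set) f"
    unfolding buchstaber_rank_def
    using LeastI[of "\<lambda>n. \<exists>f. nondegenerate_map ?K (universal_complex n :: 'p mod_ring vec set set) f",
        OF nondegenerate_unit_vecs_and_sum[OF assms(1)]]
    by blast
  have "{1..k + 1} \<in> ?K"
    using assms(1) by (simp add: skeleton_def standard_simplex_def)
  then have lower: "k + 1 \<le> ?r"
    using card_simplex_le_of_nondegenerate[OF f] by fastforce
  have small: "?r \<le> k + 1" if "m \<le> p"
    using that assms(2) by (intro rank_le nondegenerate_rational_normal_curve) simp
  have "mod_buchstaber TYPE('p) ?K = int (m + 1) - int ?r"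
    by (simp add: mod_buchstaber_def vertices_skeleton_simplex)
  then show ?thesis
    using upper lower small by auto
qed

end
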